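(* Let $U,V\subset\mathbb{R}^n$ be open and connected, and let $\psi:U\times V\to\mathbb{R}$ admit the representation $$\psi(x,y)=\sum_{s=1}^{\infty}\phi_s(x)\,\xi_s(y),\qquad (x,y)\in U\times V,$$ where the series converges absolutely for all $x\in U$, $y\in V$, with functions $\phi_s:U\to\mathbb{R}$ and $\xi_s:V\to\mathbb{R}$ such that the collection $\{\xi_s\}_{s\ge1}$ is locally linear independent in $V$, and such that for any $k\in\mathbb{N}$ there is a set of $k$ functions among the $\phi_s$ that is locally linear independent in $U$. Then $\psi$ has full rank a.e. in $U\times V$.
   Context: A (finite or countably infinite) collection of functions $f_s:U\to\mathbb{R}$ on an open set $U\subset\mathbb{R}^n$ is called locally linear independent in $U$ if for every nonempty open subset $W\subset U$ and all real coefficients $\alpha_s$: $\sum_s\alpha_s f_s(x)=0$ for (Lebesgue) almost every $x\in W$ if and only if $\alpha_s=0$ for all $s$ (for an infinite collection the sum is an infinite series). A function $\psi:U\times V\to\mathbb{R}$ has full rank almost everywhere (a.e.) in $U\times V$ if for any $k\in\mathbb{N}$ and any nonempty open sets $U_i\subset U$, $V_j\subset V$, $i,j=1,\dots,k$, there exist $x_i\in U_i$ and $y_j\in V_j$ such that the $k\times k$ matrix $\{\psi(x_i,y_j)\}_{i,j=1}^k$ has rank $k$. *)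

theory Defs
  imports "HOL-Analysis.Analysis" "Jordan_Normal_Form.DL_Rank"
begin

text \<open>A finite or countably infinite collection is indexed by a set \<open>S\<close> of natural numbers.
  For infinite \<open>S\<close> the linear combination is an infinite series in the order of the indices, and
  its vanishing includes its (possibly conditional) convergence; \<^const>\<open>suminf\<close> would assign a
  meaningless value to a divergent series. For finite \<open>S\<close> the series is the finite sum over \<open>S\<close>,
  as the lemma below the definition confirms.\<close>

definition locally_linear_independent ::
  "'a::euclidean_space set \<Rightarrow> nat set \<Rightarrow> (nat \<Rightarrow> 'a \<Rightarrow> real) \<Rightarrow> bool" where
  "locally_linear_independent U S f \<longleftrightarrow>
     (\<forall>W \<alpha>. open W \<and> W \<noteq> {} \<and> W \<subseteq> U \<longrightarrow>
        ((AE x\<in>W in lebesgue. (\<lambda>s. if s \<in> S then \<alpha> s * f s x else 0) sums 0)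
          \<longleftrightarrow> (\<forall>s\<in>S. \<alpha> s = 0)))"

lemma locally_linear_independent_finite:
  assumes "finite S"
  shows "locally_linear_independent U S f \<longleftrightarrow>
     (\<forall>W \<alpha>. open W \<and> W \<noteq> {} \<and> W \<subseteq> U \<longrightarrow>
        ((AE x\<in>W in lebesgue. (\<Sum>s\<in>S. \<alpha> s * f s x) = 0) \<longleftrightarrow> (\<forall>s\<in>S. \<alpha> s = 0)))"
proof -
  have "(\<lambda>s. if s \<in> S then \<alpha> s * f s x else 0) sums 0 \<longleftrightarrow> (\<Sum>s\<in>S. \<alpha> s * f s x) = 0"
    for \<alpha> x
    using sums_If_finite_set[OF assms, of "\<lambda>s. \<alpha> s * f s x"] sums_unique2 by fastforce
  then show ?thesis
    unfolding locally_linear_independent_def by simp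
qed

text \<open>The indices \<open>1, \<dots>, k\<close> are shifted to \<open>0, \<dots>, k - 1\<close>, and \<open>vec_space.rank k\<close> is the rank of
  a matrix with \<open>k\<close> rows.\<close>

definition full_rank_ae ::
  "'a::euclidean_space set \<Rightarrow> 'b::euclidean_space set \<Rightarrow> ('a \<times> 'b \<Rightarrow> real) \<Rightarrow> bool" where
  "full_rank_ae U V \<psi> \<longleftrightarrow>
     (\<forall>(k::nat) A B.
        (\<forall>i<k. open (A i) \<and> A i \<noteq> {} \<and> A i \<subseteq> U) \<and>
        (\<forall>j<k. open (B j) \<and> B j \<noteq> {} \<and> B j \<subseteq> V) \<longrightarrow>
        (\<exists>x y. (\<forall>i<k. x i \<in> A i) \<and> (\<forall>j<k. y j \<in> B j) \<and>
           vec_space.rank k (Matrix.mat k k (\<lambda>(i, j). \<psi> (x i, y j))) = k))"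

end

theory Submission
  imports Defs
begin

text \<open>Sample points can be chosen one after another: expanding the determinant along the last
  column turns it into a linear combination of the functions at the new point, whose last
  coefficient is the previous determinant. Applied first to the \<open>\<phi>\<close>, this yields points \<open>x\<^sub>i\<close> such that
  a combination \<open>\<Sum>\<^sub>i c\<^sub>i \<phi>\<^sub>s(x\<^sub>i)\<close> with \<open>c \<noteq> 0\<close> cannot vanish for all \<open>s\<close>. These sums are the coefficients of
  \<open>\<Sum>\<^sub>i c\<^sub>i \<psi>(x\<^sub>i, \<cdot>)\<close> with respect to the \<open>\<xi>\<close>, so the functions \<open>\<psi>(x\<^sub>i, \<cdot>)\<close> are locally linearly
  independent and the same argument yields the \<open>y\<^sub>j\<close>.\<close>

lemma ex_sample_points_det_nonzero:
  fixes g :: "nat \<Rightarrow> 'a \<Rightarrow> 'b::idom"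
  assumes "\<And>c j. j < k \<Longrightarrow> \<exists>i<k. c i \<noteq> 0 \<Longrightarrow> \<exists>y\<in>B j. (\<Sum>i<k. c i * g i y) \<noteq> 0"
  shows "\<exists>y. (\<forall>j<k. y j \<in> B j) \<and> Determinant.det (Matrix.mat k k (\<lambda>(i, j). g i (y j))) \<noteq> 0"
  using assms
proof (induction k)
  case 0
  show ?case
    by (simp add: det_dim_zero)
next
  case (Suc k)
  have "\<exists>y\<in>B j. (\<Sum>i<k. c i * g i y) \<noteq> 0" if "j < k" "\<exists>i<k. c i \<noteq> 0" for c j
  proof -
    \<comment> \<open>Padding \<open>c\<close> with a zero at \<open>k\<close> lets the first
      \<open>k\<close> functions inherit the hypothesis.\<close>
    have "\<exists>y\<in>B j. (\<Sum>i<Suc k. (c(k := 0)) i * g i y) \<noteq> 0"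
      using that by (intro Suc.prems) (auto simp: less_Suc_eq)
    then show ?thesis
      by simp
  qed
  then obtain y where y: "\<forall>j<k. y j \<in> B j"
    and nz: "Determinant.det (Matrix.mat k k (\<lambda>(i, j). g i (y j))) \<noteq> 0"
    using Suc.IH by blast
  define M where "M z = Matrix.mat (Suc k) (Suc k) (\<lambda>(i, j). g i ((y(k := z)) j))" for z
  \<comment> \<open>A cofactor along column \<open>k\<close> ignores that column, the only place
    where \<open>z\<close> enters; hence \<open>undefined\<close> can stand for the point still to
    be chosen.\<close>
  define c where "c i = cofactor (M undefined) i k" for i
  have cofactor_M: "cofactor (M z) i k = c i" for z i
  proof -
    have "mat_delete (M z) i k = mat_delete (M undefined) i k"
      by (rule eq_matI) (auto simp: mat_delete_def M_def)
    then show ?thesis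
      by (simp add: c_def cofactor_def)
  qed
  \<comment> \<open>The sign at position \<open>(k, k)\<close> is positive, so \<open>c k\<close> is
    exactly the determinant already known to be nonzero.\<close>
  have "mat_delete (M undefined) k k = Matrix.mat k k (\<lambda>(i, j). g i (y j))"
    by (rule eq_matI) (auto simp: mat_delete_def M_def)
  then have "c k \<noteq> 0"
    using nz by (simp add: c_def cofactor_def)
  then obtain z where z: "z \<in> B k" "(\<Sum>i<Suc k. c i * g i z) \<noteq> 0"
    using Suc.prems[of k c] by auto
  have "Determinant.det (M z) = (\<Sum>i<Suc k. M z $$ (i, k) * cofactor (M z) i k)"
    by (rule laplace_expansion_column) (auto simp: M_def)
  also have "\<dots> = (\<Sum>i<Suc k. c i * g i z)"
    unfolding cofactor_M by (rule sum.cong) (auto simp: M_def)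
  finally have "Determinant.det (M z) \<noteq> 0"
    using z by simp
  moreover have "\<forall>j<Suc k. (y(k := z)) j \<in> B j"
    using y z by (auto simp: less_Suc_eq)
  ultimately show ?case
    unfolding M_def by blast
qed

text \<open>A combination vanishing on all of \<open>W\<close> vanishes almost everywhere there,
  which would force \<open>\<alpha> s = 0\<close>.\<close>

lemma locally_linear_independent_ex_sum_nonzero:
  assumes "locally_linear_independent U S f" "finite S"
    and "open W" "W \<noteq> {}" "W \<subseteq> U" "s \<in> S" "\<alpha> s \<noteq> 0"
  shows "\<exists>x\<in>W. (\<Sum>s\<in>S. \<alpha> s * f s x) \<noteq> 0"
proof (rule ccontr)
  assume "\<not> ?thesis"
  then have "AE x\<in>W in lebesgue. (\<Sum>s\<in>S. \<alpha> s * f s x) = 0"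
    by simp
  then show False
    using assms unfolding locally_linear_independent_finite[OF \<open>finite S\<close>] by blast
qed

theorem proposition2:
  fixes U V :: "(real ^ 'n) set"
    and \<psi> :: "(real ^ 'n) \<times> (real ^ 'n) \<Rightarrow> real"
    and \<phi> \<xi> :: "nat \<Rightarrow> real ^ 'n \<Rightarrow> real"
  assumes "open U" "connected U" "open V" "connected V"
    and "\<And>x y. x \<in> U \<Longrightarrow> y \<in> V \<Longrightarrow> summable (\<lambda>s. \<bar>\<phi> s x * \<xi> s y\<bar>)"
    and "\<And>x y. x \<in> U \<Longrightarrow> y \<in> V \<Longrightarrow> \<psi> (x, y) = (\<Sum>s. \<phi> s x * \<xi> s y)"
    and "locally_linear_independent V UNIV \<xi>"
    and "\<And>k. \<exists>S. finite S \<and> card S = k \<and> locally_linear_independent U S \<phi>"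
  shows "full_rank_ae U V \<psi>"
  unfolding full_rank_ae_def
proof (intro allI impI, elim conjE)
  fix k :: nat and A B :: "nat \<Rightarrow> (real ^ 'n) set"
  assume A: "\<forall>i<k. open (A i) \<and> A i \<noteq> {} \<and> A i \<subseteq> U"
    and B: "\<forall>j<k. open (B j) \<and> B j \<noteq> {} \<and> B j \<subseteq> V"
  obtain S where S: "finite S" "card S = k" "locally_linear_independent U S \<phi>"
    using assms(8) by blast
  obtain e where e: "bij_betw e {..<k} S"
    using ex_bij_betw_nat_finite[OF S(1)] S(2) by (auto simp: atLeast0LessThan)
  have "\<exists>x\<in>A j. (\<Sum>i<k. c i * \<phi> (e i) x) \<noteq> 0"
    if j: "j < k" and c: "\<exists>i<k. c i \<noteq> 0" for c j
  proof -
    \<comment> \<open>Independence of the chosen \<phi> takes coefficients indexed by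
      \<open>S\<close>, so \<open>c\<close> is transported along the enumeration
      \<open>e\<close>.\<close>
    define \<alpha> where "\<alpha> = c \<circ> inv_into {..<k} e"
    have \<alpha>: "\<alpha> (e i) = c i" if "i < k" for i
      using e that by (auto simp: \<alpha>_def bij_betw_def)
    obtain i where "i < k" "c i \<noteq> 0"
      using c by blast
    then have "e i \<in> S" "\<alpha> (e i) \<noteq> 0"
      using e \<alpha> by (auto simp: bij_betw_def)
    then obtain x where "x \<in> A j" "(\<Sum>s\<in>S. \<alpha> s * \<phi> s x) \<noteq> 0"
      using locally_linear_independent_ex_sum_nonzero[OF S(3,1)] A j by metis
    moreover have "(\<Sum>s\<in>S. \<alpha> s * \<phi> s x) = (\<Sum>i<k. c i * \<phi> (e i) x)"
      by (simp add: sum.reindex_bij_betw[OF e, symmetric] \<alpha>)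
    ultimately show ?thesis
      by auto
  qed
  then obtain x where x: "\<forall>i<k. x i \<in> A i"
    and det_x: "Determinant.det (Matrix.mat k k (\<lambda>(i, j). \<phi> (e i) (x j))) \<noteq> 0"
    using ex_sample_points_det_nonzero[of k A "\<lambda>i. \<phi> (e i)"] by blast
  have "\<exists>y\<in>B j. (\<Sum>i<k. c i * \<psi> (x i, y)) \<noteq> 0"
    if j: "j < k" and c: "\<exists>i<k. c i \<noteq> 0" for c j
  proof (rule ccontr)
    \<comment> \<open>\<open>d s\<close> is the coefficient of \<open>\<xi> s\<close> once the
      finite sum over \<open>i\<close> is moved inside the series.\<close>
    define d where "d s = (\<Sum>i<k. c i * \<phi> s (x i))" for s
    assume "\<not> ?thesis"
    then have zero: "(\<Sum>i<k. c i * \<psi> (x i, y)) = 0" if "y \<in> B j" for y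
      using that by blast
    have "(\<lambda>s. d s * \<xi> s y) sums 0" if y: "y \<in> B j" for y
    proof -
      have "(\<lambda>s. \<phi> s (x i) * \<xi> s y) sums \<psi> (x i, y)" if "i < k" for i
      proof -
        have "x i \<in> U" "y \<in> V"
          using that x A B j y by blast+
        then show ?thesis
          using summable_sums[OF summable_rabs_cancel[OF assms(5)]] assms(6) by simp
      qed
      then have "(\<lambda>s. \<Sum>i<k. c i * (\<phi> s (x i) * \<xi> s y)) sums (\<Sum>i<k. c i * \<psi> (x i, y))"
        by (intro sums_sum sums_mult) auto
      then show ?thesis
        by (simp add: zero[OF y] d_def sum_distrib_right mult.assoc)
    qed
    \<comment> \<open>Independence of the infinite family \<xi> now makes every \<open>d s\<close>
      vanish.\<close>
    then have "AE y\<in>B j in lebesgue. (\<lambda>s. if s \<in> UNIV then d s * \<xi> s y else 0) sums 0"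
      by simp
    moreover have "open (B j) \<and> B j \<noteq> {} \<and> B j \<subseteq> V"
      using B j by simp
    ultimately have d: "d s = 0" for s
      using assms(7)[unfolded locally_linear_independent_def, rule_format, of "B j" d] by simp
    define M where "M = Matrix.mat k k (\<lambda>(i, j). \<phi> (e i) (x j))"
    \<comment> \<open>Entry \<open>i\<close> of this product is \<open>d (e i)\<close>, so the
      nonzero vector \<open>c\<close> lies in the kernel of a matrix whose determinant is nonzero by
      the choice of \<open>x\<close>.\<close>
    have "M *\<^sub>v Matrix.vec k c = 0\<^sub>v k"
    proof (rule eq_vecI)
      fix i assume "i < dim_vec (0\<^sub>v k :: real Matrix.vec)"
      then show "vec_index (M *\<^sub>v Matrix.vec k c) i = vec_index (0\<^sub>v k) i"
        using d[of "e i"]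
        by (simp add: M_def d_def scalar_prod_def mult.commute atLeast0LessThan)
    qed (simp add: M_def)
    moreover have "Matrix.vec k c \<noteq> 0\<^sub>v k"
      using c by (metis index_vec index_zero_vec(1))
    moreover have "M \<in> carrier_mat k k" "Matrix.vec k c \<in> carrier_vec k"
      by (simp_all add: M_def)
    ultimately have "Determinant.det M = 0"
      using det_0_iff_vec_prod_zero by blast
    then show False
      using det_x by (simp add: M_def)
  qed
  then obtain y where y: "\<forall>j<k. y j \<in> B j"
    and "Determinant.det (Matrix.mat k k (\<lambda>(i, j). \<psi> (x i, y j))) \<noteq> 0"
    using ex_sample_points_det_nonzero[of k B "\<lambda>i y. \<psi> (x i, y)"] by blast
  then have "vec_space.rank k (Matrix.mat k k (\<lambda>(i, j). \<psi> (x i, y j))) = k"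
    using vec_space.det_rank_iff[OF mat_carrier] by blast
  with x y show "\<exists>x y. (\<forall>i<k. x i \<in> A i) \<and> (\<forall>j<k. y j \<in> B j) \<and>
      vec_space.rank k (Matrix.mat k k (\<lambda>(i, j). \<psi> (x i, y j))) = k"
    by blast
qed

end
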